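(* Let $q\ge 2$ be even and let $\mathbf f\in A_q^+$ be a forbidden factor whose last symbol is $0$. Then $\mathbf f$ does not induce zero periodicity on $A_q^\infty$ if and only if $\mathbf f\in U_q$.
   Context: $A_q=\{0,1,\dots,q-1\}$. $A_q^n$ is the set of words of length $n$ over $A_q$, $A_q^*$ (resp. $A_q^+$) the set of all (resp. all nonempty) finite words, $\epsilon$ the empty word, $A_q^\infty$ the set of right-infinite words $a_1a_2a_3\cdots$. For a word $\mathbf a$, $\mathbf a^i$ is the $i$-fold concatenation ($\mathbf a^0=\epsilon$), $\mathbf a^\infty=\mathbf a\mathbf a\mathbf a\cdots$ and $\mathbf a^{-\infty}=\cdots\mathbf a\mathbf a\mathbf a$ is the left-infinite word; a suffix of a left-infinite word is a finite (possibly empty) word with which it ends. $\mathbf f$ is a factor of $\mathbf a$ if $\mathbf a=\mathbf b\mathbf f\mathbf c$. For a set $X$ of words, $X(\mathbf f)$ is the set of words of $X$ not containing $\mathbf f$ as a factor, and $\mathbf p|X$ the set of words of $X$ having prefix $\mathbf p$. An infinite word $\mathbf a$ has ultimate period $\mathbf c\ne\epsilon$ if $\mathbf a=\mathbf b\mathbf c^\infty$ for some finite $\mathbf b$. Reflected Gray Code order: for distinct words $\mathbf s,\mathbf t$ of the same (finite or infinite) length, let $k$ be the leftmost position where they differ and $u=\sum_{i<k}s_i$; then $\mathbf s\prec\mathbf t$ iff ($u$ even and $s_k<t_k$) or ($u$ odd and $s_k>t_k$). Dual Reflected Gray Code order: with also $v$ the number of nonzero symbols among $s_1,\dots,s_{k-1}$,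 $\mathbf s\triangleleft\mathbf t$ iff ($u+v$ even and $s_k<t_k$) or ($u+v$ odd and $s_k>t_k$). The appropriate order is $\prec$ when $q$ is even and $\triangleleft$ when $q$ is odd; "first"/"last" mean least/greatest in the appropriate order. A factor $\mathbf f$ induces zero periodicity on $A_q^\infty$ if for every $\mathbf p\in A_q^*(\mathbf f)$ the first and the last words of $\mathbf p|A_q^\infty(\mathbf f)$ both have ultimate period $0$. For even $q$, $U_q=\bigcup_{m\ge 0}\{\mathbf b0 : \mathbf b \text{ a suffix of } (1(q-1)0^m)^{-\infty}\}$. *)

theory Defs
  imports Main "HOL-Library.Stream" "HOL-Library.Sublist"
begin

text \<open>
  Finite words over the alphabet \<open>{..<q}\<close> are elements of \<open>lists {..<q}\<close>,
  right-infinite words are elements of \<open>streams {..<q}\<close>. Positions are counted from 0.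
\<close>

definition inf_factor :: "'a list \<Rightarrow> 'a stream \<Rightarrow> bool" where
  "inf_factor f a \<longleftrightarrow> (\<exists>b c. a = b @- f @- c)"

definition words_avoiding :: "nat \<Rightarrow> nat list \<Rightarrow> nat list set" where
  "words_avoiding q f = {a \<in> lists {..<q}. \<not> sublist f a}"

definition inf_words_avoiding :: "nat \<Rightarrow> nat list \<Rightarrow> nat stream set" where
  "inf_words_avoiding q f = {a \<in> streams {..<q}. \<not> inf_factor f a}"

definition with_prefix :: "'a list \<Rightarrow> 'a stream set \<Rightarrow> 'a stream set" where
  "with_prefix p X = {a \<in> X. \<exists>c. a = p @- c}"

definition ultimate_period :: "'a stream \<Rightarrow> 'a list \<Rightarrow> bool" where
  "ultimate_period a c \<longleftrightarrow> c \<noteq> [] \<and> (\<exists>b. a = b @- cycle c)"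

definition rgc_less :: "nat stream \<Rightarrow> nat stream \<Rightarrow> bool" where
  "rgc_less s t \<longleftrightarrow>
    (\<exists>k. (\<forall>i<k. s !! i = t !! i) \<and>
         (let u = (\<Sum>i<k. s !! i)
          in (even u \<and> s !! k < t !! k) \<or> (odd u \<and> s !! k > t !! k)))"

definition dual_rgc_less :: "nat stream \<Rightarrow> nat stream \<Rightarrow> bool" where
  "dual_rgc_less s t \<longleftrightarrow>
    (\<exists>k. (\<forall>i<k. s !! i = t !! i) \<and>
         (let u = (\<Sum>i<k. s !! i); v = card {i. i < k \<and> s !! i \<noteq> 0}
          in (even (u + v) \<and> s !! k < t !! k) \<or> (odd (u + v) \<and> s !! k > t !! k)))"

definition appropriate_less :: "nat \<Rightarrow> nat stream \<Rightarrow> nat stream \<Rightarrow> bool" where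
  "appropriate_less q = (if even q then rgc_less else dual_rgc_less)"

definition is_first :: "nat \<Rightarrow> nat stream set \<Rightarrow> nat stream \<Rightarrow> bool" where
  "is_first q X a \<longleftrightarrow> a \<in> X \<and> (\<forall>b\<in>X. b \<noteq> a \<longrightarrow> appropriate_less q a b)"

definition is_last :: "nat \<Rightarrow> nat stream set \<Rightarrow> nat stream \<Rightarrow> bool" where
  "is_last q X a \<longleftrightarrow> a \<in> X \<and> (\<forall>b\<in>X. b \<noteq> a \<longrightarrow> appropriate_less q b a)"

text \<open>
  The appropriate order is a strict linear order, so a first (last) word is unique if it exists;
  its existence is part of the following definition.
\<close>

definition induces_zero_periodicity :: "nat \<Rightarrow> nat list \<Rightarrow> bool" where
  "induces_zero_periodicity q f \<longleftrightarrow>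
    (\<forall>p \<in> words_avoiding q f.
       (\<exists>a. is_first q (with_prefix p (inf_words_avoiding q f)) a \<and> ultimate_period a [0]) \<and>
       (\<exists>a. is_last q (with_prefix p (inf_words_avoiding q f)) a \<and> ultimate_period a [0]))"

text \<open>
  A left-infinite word is represented by the stream of its symbols read from right to left.
\<close>

definition left_power_inf :: "'a list \<Rightarrow> 'a stream" where
  "left_power_inf c = cycle (rev c)"

definition left_inf_suffix :: "'a list \<Rightarrow> 'a stream \<Rightarrow> bool" where
  "left_inf_suffix b l \<longleftrightarrow> (\<exists>r. l = rev b @- r)"

definition U :: "nat \<Rightarrow> nat list set" where
  "U q = (\<Union>m. {b @ [0] |b. left_inf_suffix b (left_power_inf ([1, q - 1] @ replicate m 0))})"

end

theory Submission imports Defs begin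

text \<open>
  Write \<open>f = b0\<close>. Appending a nonzero symbol never creates \<open>f\<close>, so the extremal words with a
  given prefix are built greedily, and only the symbol 0 can be blocked, namely after a word with
  suffix \<open>b\<close>. While the relevant digit sum is even the greedy choice is 0; when 0 is blocked, it
  is 1, which flips the parity, then \<open>q - 1\<close>, which flips it back. Hence an extremal word that
  does not end in zeros ends in blocks \<open>1 (q-1) 0\<^sup>k\<close>, each followed by a blocked 0. All these blocks
  have \<open>k\<close> equal to the number of trailing zeros of \<open>b\<close>, so \<open>b\<close> is a suffix of a power of one
  block. Conversely, if \<open>b\<close> is a suffix of a power of \<open>1 (q-1) 0\<^sup>m\<close>, the infinite power of that
  block avoids \<open>f\<close> and is the greedy word.
\<close>

section \<open>Factors and prefixes of infinite words\<close>

lemma inf_factor_iff_stake: "inf_factor f a \<longleftrightarrow> (\<exists>n. sublist f (stake n a))"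
proof
  assume "inf_factor f a"
  then obtain b c where "a = b @- f @- c" by (auto simp: inf_factor_def)
  then have "stake (length b + length f) a = b @ f" by (simp add: stake_shift)
  then show "\<exists>n. sublist f (stake n a)" by (metis sublist_append_leftI)
next
  assume "\<exists>n. sublist f (stake n a)"
  then obtain n b c where "stake n a = b @ f @ c" by (auto simp: sublist_def)
  then have "a = b @- f @- (c @- sdrop n a)"
    by (metis stake_sdrop shift_append)
  then show "inf_factor f a" by (auto simp: inf_factor_def)
qed

lemma sublist_imp_inf_factor: "sublist f v \<Longrightarrow> inf_factor f (v @- s)"
  unfolding inf_factor_def sublist_def by (metis shift_append)

lemma sconst_unfold: "x ## sconst x = sconst x"
  by (subst (2) siterate.code) simp

lemma stream_eqI:
  assumes "\<And>n. s !! n = t !! n"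
  shows "s = t"
  using assms smap_alt[of id s t] by (simp add: stream.map_id)

section \<open>A common order for first and last words\<close>

text \<open>
  The offset \<open>e\<close> treats first words (\<open>e = 0\<close>) and last words (\<open>e = 1\<close>) alike: an odd offset
  reverses the order.
\<close>

definition parity_less :: "nat \<Rightarrow> nat stream \<Rightarrow> nat stream \<Rightarrow> bool" where
  "parity_less e s t \<longleftrightarrow>
    (\<exists>k. (\<forall>i<k. s !! i = t !! i) \<and>
         (if even (e + (\<Sum>i<k. s !! i)) then s !! k < t !! k else t !! k < s !! k))"

definition is_best :: "nat \<Rightarrow> nat stream set \<Rightarrow> nat stream \<Rightarrow> bool" where
  "is_best e X a \<longleftrightarrow> a \<in> X \<and> (\<forall>t\<in>X. t \<noteq> a \<longrightarrow> parity_less e a t)"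

lemma parity_less_0: "parity_less 0 s t \<longleftrightarrow> rgc_less s t"
  unfolding parity_less_def rgc_less_def Let_def by (intro ex_cong1) auto

text \<open>Before the first difference both words have the same digit sum, so making the offset odd
  only exchanges their roles.\<close>

lemma parity_less_1: "parity_less 1 s t \<longleftrightarrow> rgc_less t s"
proof -
  have "(\<Sum>i<k. s !! i) = (\<Sum>i<k. t !! i)" if "\<forall>i<k. s !! i = t !! i" for k
    using that by (intro sum.cong) auto
  then show ?thesis
    unfolding parity_less_def rgc_less_def Let_def by (intro ex_cong1) auto
qed

lemma is_first_iff_is_best: "even q \<Longrightarrow> is_first q X a \<longleftrightarrow> is_best 0 X a"
  by (auto simp: is_first_def is_best_def appropriate_less_def parity_less_0)

lemma is_last_iff_is_best: "even q \<Longrightarrow> is_last q X a \<longleftrightarrow> is_best 1 X a"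
  unfolding is_last_def is_best_def appropriate_less_def parity_less_1 by auto

lemma parity_less_asym:
  assumes "parity_less e s t" "parity_less e t s"
  shows False
proof -
  from assms(1) obtain k where k: "\<forall>i<k. s !! i = t !! i"
    "if even (e + (\<Sum>i<k. s !! i)) then s !! k < t !! k else t !! k < s !! k"
    by (auto simp: parity_less_def)
  from assms(2) obtain l where l: "\<forall>i<l. t !! i = s !! i"
    "if even (e + (\<Sum>i<l. t !! i)) then t !! l < s !! l else s !! l < t !! l"
    by (auto simp: parity_less_def)
  have "s !! k \<noteq> t !! k" "s !! l \<noteq> t !! l" using k(2) l(2) by (auto split: if_splits)
  with k(1) l(1) have "k = l" by (metis linorder_neqE_nat)
  moreover have "(\<Sum>i<k. s !! i) = (\<Sum>i<k. t !! i)" using k(1) by (intro sum.cong) auto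
  ultimately show False using k(2) l(2) by (auto split: if_splits)
qed

lemma is_best_unique: "is_best e X a \<Longrightarrow> is_best e X a' \<Longrightarrow> a = a'"
  unfolding is_best_def using parity_less_asym by metis

lemma parity_less_shift:
  assumes "if even (e + sum_list v) then x < y else y < x"
  shows "parity_less e (v @- x ## s) (v @- y ## t)"
proof -
  have "(\<Sum>i<length v. (v @- x ## s) !! i) = (\<Sum>i<length v. v ! i)"
    by (intro sum.cong) auto
  also have "\<dots> = sum_list v" by (simp add: sum_list_sum_nth lessThan_atLeast0)
  finally show ?thesis
    unfolding parity_less_def using assms by (intro exI[of _ "length v"]) (auto simp: shift_snth)
qed

section \<open>Powers of a word and the set \<open>U\<close>\<close>

lemma concat_replicate_Suc: "concat (replicate (Suc n) c) = concat (replicate n c) @ c"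
  by (induction n) auto

lemma cycle_eq_power_shift: "c \<noteq> [] \<Longrightarrow> cycle c = concat (replicate n c) @- cycle c"
  by (induction n) (simp, metis concat_replicate_Suc cycle_decomp shift_append)

text \<open>Trades the reversed stream for finite powers, the form in which blocks arise from the
  greedy construction.\<close>

lemma left_inf_suffix_power_iff:
  assumes "c \<noteq> []"
  shows "left_inf_suffix b (left_power_inf c) \<longleftrightarrow> (\<exists>n. suffix b (concat (replicate n c)))"
proof -
  have rev: "rev (concat (replicate n c)) = concat (replicate n (rev c))" for n
    by (simp add: rev_concat)
  have eq: "cycle (rev c) = concat (replicate n (rev c)) @- cycle (rev c)" for n
    using cycle_eq_power_shift assms by blast
  show ?thesis
  proof
    assume "left_inf_suffix b (left_power_inf c)"
    then obtain r where r: "cycle (rev c) = rev b @- r"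
      by (auto simp: left_inf_suffix_def left_power_inf_def)
    \<comment> \<open>Since \<open>c\<close> is nonempty, \<open>length b\<close> copies of it are
      long enough to cover \<open>b\<close>.\<close>
    let ?p = "concat (replicate (length b) (rev c))"
    have "length b * 1 \<le> length b * length c" using assms by (intro mult_le_mono) (auto simp: Suc_leI)
    then have "length b \<le> length ?p" by (simp add: length_concat sum_list_replicate)
    then have "stake (length b) (?p @- cycle (rev c)) = take (length b) ?p" by (simp add: stake_shift)
    moreover have "stake (length b) (?p @- cycle (rev c)) = rev b"
      unfolding eq[symmetric] unfolding r by (simp add: stake_shift)
    ultimately have "prefix (rev b) ?p" by (metis take_is_prefix)
    then show "\<exists>n. suffix b (concat (replicate n c))" by (metis rev suffix_to_prefix)
  next
    assume "\<exists>n. suffix b (concat (replicate n c))"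
    then obtain n where "prefix (rev b) (concat (replicate n (rev c)))"
      unfolding suffix_to_prefix rev by blast
    then obtain s where "concat (replicate n (rev c)) = rev b @ s" by (auto simp: prefix_def)
    with eq[of n] show "left_inf_suffix b (left_power_inf c)"
      by (auto simp: left_inf_suffix_def left_power_inf_def)
  qed
qed

lemma U_iff:
  "b @ [0] \<in> U q \<longleftrightarrow> (\<exists>m n. suffix b (concat (replicate n ([1, q - 1] @ replicate m 0))))"
  by (simp add: U_def left_inf_suffix_power_iff)

text \<open>The exponent can be chosen so that \<open>b\<close> ends in a full run of
  \<open>m\<close> zeros. This can fail for the given \<open>m\<close> only if \<open>b\<close>
  itself consists of fewer than \<open>m\<close> zeros, and then \<open>m\<close> is lowered to
  \<open>length b\<close>.\<close>

lemma U_suffix_zeros: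
  assumes "b @ [0] \<in> U q"
  shows "\<exists>m n. suffix b (concat (replicate n ([1, q - 1] @ replicate m 0))) \<and>
    suffix (replicate m 0) b"
proof -
  obtain m n where mn: "suffix b (concat (replicate n ([1, q - 1] @ replicate m 0)))"
    using assms U_iff by blast
  show ?thesis
  proof (cases n)
    case 0
    then have "b = []" using mn by simp
    then show ?thesis by (intro exI[of _ 0]) simp
  next
    case (Suc k)
    have zeros: "suffix (replicate m 0) (concat (replicate n ([1, q - 1] @ replicate m 0)))"
      unfolding Suc concat_replicate_Suc by (intro suffix_appendI) simp
    show ?thesis
    proof (cases "m \<le> length b")
      case True
      then show ?thesis using suffix_length_suffix[OF zeros mn] mn by auto
    next
      case False
      then have "suffix b (replicate m 0)" using suffix_length_suffix[OF mn zeros] by simp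
      then have "b = replicate (length b) 0"
        by (metis in_set_replicate replicate_eqI set_mono_suffix subsetD)
      then have "suffix b (concat (replicate 1 ([1, q - 1] @ replicate (length b) 0)))"
        "suffix (replicate (length b) 0) b"
        by (simp_all add: suffix_ConsI)
      then show ?thesis by blast
    qed
  qed
qed

section \<open>Runs of zeros\<close>

lemma count_list_rotate: "count_list (rotate n xs) x = count_list xs x"
  by (metis add.commute append_take_drop_id count_list_append rotate_drop_take)

text \<open>Every window of length \<open>m + 2\<close> is a rotation of the period and so contains
  exactly \<open>m\<close> zeros. A window starting at a run of \<open>m + 1\<close> zeros would
  contain too many.\<close>

lemma no_long_zero_run:
  assumes "x \<noteq> 0" "y \<noteq> (0 :: nat)"
  shows "\<not> inf_factor (replicate (Suc m) 0) (cycle ([x, y] @ replicate m 0))"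
proof
  let ?c = "[x, y] @ replicate m 0"
  assume "inf_factor (replicate (Suc m) 0) (cycle ?c)"
  then obtain u t where "cycle ?c = u @- replicate (Suc m) 0 @- t" by (auto simp: inf_factor_def)
  then have "sdrop (length u) (cycle ?c) = replicate (Suc m) 0 @- t"
    by (simp add: sdrop_shift)
  then have "cycle (rotate (length u mod length ?c) ?c) = replicate (Suc m) 0 @- t"
    by (subst (asm) sdrop_cycle) auto
  then have "stake (length ?c) (cycle (rotate (length u mod length ?c) ?c)) =
      stake (length ?c) (replicate (Suc m) 0 @- t)" by (rule arg_cong)
  moreover have "stake (length ?c) (cycle (rotate k ?c)) = rotate k ?c" for k
    using stake_cycle_eq[of "rotate k ?c"] by simp
  moreover have "stake (length ?c) (replicate (Suc m) 0 @- t) = replicate (Suc m) 0 @ [shd t]"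
    unfolding stake_shift by simp
  ultimately have "rotate (length u mod length ?c) ?c = replicate (Suc m) 0 @ [shd t]"
    by metis
  then have "count_list ?c 0 = count_list (replicate (Suc m) 0 @ [shd t]) 0"
    by (metis count_list_rotate)
  moreover have "count_list (replicate k (0 :: nat)) 0 = k" for k by (induction k) auto
  ultimately show False using assms by simp
qed

lemma split_trailing_zeros: "\<exists>ys z. xs = ys @ replicate z 0 \<and> (ys = [] \<or> last ys \<noteq> 0)"
proof (induction xs rule: rev_induct)
  case (snoc x xs)
  then obtain ys z where ys: "xs = ys @ replicate z 0" "ys = [] \<or> last ys \<noteq> 0" by blast
  show ?case
  proof (cases "x = 0")
    case True
    then show ?thesis using ys
      by (intro exI[of _ ys] exI[of _ "Suc z"]) (simp add: replicate_append_same)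
  next
    case False
    then show ?thesis by (intro exI[of _ "xs @ [x]"] exI[of _ 0]) simp
  qed
qed simp

lemma trailing_zeros_unique:
  assumes "u @ x # replicate k 0 = v @ y # replicate l 0" "x \<noteq> 0" "y \<noteq> 0"
  shows "k = l"
proof -
  have "length (takeWhile (\<lambda>i. i = 0) (rev (w @ z # replicate n 0))) = n" if "z \<noteq> 0" for w z n
    using that by (subst rev_append, simp, subst takeWhile_append2) auto
  then show ?thesis using assms by metis
qed

section \<open>Greedy continuations and their optimality\<close>

context
  fixes q :: nat and b :: "nat list"
begin

text \<open>
  One step runs from a prefix of even parity (offset included) to the next such prefix, so a
  blocked 0 contributes two symbols at once.
\<close>

inductive greedy_step :: "nat list \<Rightarrow> nat list \<Rightarrow> bool" where
  zero: "\<not> suffix b v \<Longrightarrow> greedy_step v (v @ [0])"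
| one_top: "suffix b v \<Longrightarrow> greedy_step v (v @ [1, q - 1])"

abbreviation "greedy \<equiv> greedy_step\<^sup>*\<^sup>*"

abbreviation "words \<equiv> words_avoiding q (b @ [0])"
abbreviation "inf_words \<equiv> inf_words_avoiding q (b @ [0])"

lemma snoc_nonzero_in_words:
  "v \<in> words \<Longrightarrow> x < q \<Longrightarrow> x \<noteq> 0 \<Longrightarrow> v @ [x] \<in> words"
  by (auto simp: words_avoiding_def sublist_snoc)

lemma greedy_step_words:
  assumes "q \<ge> 2" "greedy_step v w" "v \<in> words"
  shows "w \<in> words"
  using assms(2)
proof cases
  case zero
  then show ?thesis using assms by (auto simp: words_avoiding_def sublist_snoc)
next
  case one_top
  have "(v @ [1]) @ [q - 1] \<in> words"
    using assms by (intro snoc_nonzero_in_words) auto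
  then show ?thesis using one_top by simp
qed

lemma greedy_words: "greedy v w \<Longrightarrow> q \<ge> 2 \<Longrightarrow> v \<in> words \<Longrightarrow> w \<in> words"
  by (induction rule: rtranclp_induct) (auto intro: greedy_step_words)

text \<open>A step adds either 0 or \<open>1 + (q - 1) = q\<close> to the digit sum, and both are
  even.\<close>

lemma greedy_step_parity:
  "greedy_step v w \<Longrightarrow> q \<ge> 2 \<Longrightarrow> even q \<Longrightarrow> even (sum_list w) = even (sum_list v)"
  by (induction rule: greedy_step.induct) auto

lemma greedy_parity:
  "greedy v w \<Longrightarrow> q \<ge> 2 \<Longrightarrow> even q \<Longrightarrow> even (sum_list w) = even (sum_list v)"
  by (induction rule: rtranclp_induct) (auto simp: greedy_step_parity)

lemma greedy_prefix: "greedy v w \<Longrightarrow> \<exists>u. w = v @ u"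
  by (induction rule: rtranclp_induct) (auto elim!: greedy_step.cases)

text \<open>At even parity small symbols are better: 0 if allowed, otherwise 1. After that 1 the
  parity is odd, so the top symbol \<open>q - 1\<close> is best. Any competitor leaving this path
  loses within the step, whatever the tail \<open>s\<close>.\<close>

lemma greedy_step_dominates:
  assumes step: "greedy_step v w" and par: "even (e + sum_list v)"
    and t: "v @- r \<in> inf_words"
  shows "(\<exists>r'. v @- r = w @- r') \<or> parity_less e (w @- s) (v @- r)"
  using step
proof cases
  case zero
  obtain x r' where r: "r = x ## r'" by (cases r)
  show ?thesis
  proof (cases "x = 0")
    case True
    then show ?thesis using zero r by auto
  next
    case False
    then have "parity_less e (v @- 0 ## s) (v @- x ## r')"
      using par by (intro parity_less_shift) auto
    then show ?thesis using zero r by simp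
  qed
next
  case one_top
  obtain x y r' where r: "r = x ## y ## r'" by (metis stream.collapse)
  have q: "y < q" using t r by (auto simp: inf_words_avoiding_def streams_iff_sset)
  have "x \<noteq> 0"
  proof
    assume "x = 0"
    moreover have "sublist (b @ [0]) (v @ [0])" using one_top by (simp add: sublist_snoc)
    ultimately have "inf_factor (b @ [0]) (v @- r)"
      using sublist_imp_inf_factor[of "b @ [0]" "v @ [0]" "y ## r'"] r by simp
    then show False using t by (simp add: inf_words_avoiding_def)
  qed
  then consider "x > 1" | "x = 1" "y = q - 1" | "x = 1" "y < q - 1"
    using q by linarith
  then show ?thesis
  proof cases
    case 1
    then have "parity_less e (v @- 1 ## (q - 1) ## s) (v @- x ## y ## r')"
      using par by (intro parity_less_shift) auto
    then show ?thesis using one_top r by simp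
  next
    case 2
    then show ?thesis using one_top r by auto
  next
    case 3
    then have "parity_less e ((v @ [1]) @- (q - 1) ## s) ((v @ [1]) @- y ## r')"
      using par by (intro parity_less_shift) auto
    then show ?thesis using one_top r 3 by simp
  qed
qed

text \<open>The domination is stated for all tails \<open>s\<close> because further greedy steps
  then only specialise the tail, which lets the induction pass through.\<close>

lemma greedy_dominates:
  assumes "greedy v w" "q \<ge> 2" "even q" "even (e + sum_list v)" "v @- r \<in> inf_words"
  shows "(\<exists>r'. v @- r = w @- r') \<or> (\<forall>s. parity_less e (w @- s) (v @- r))"
  using assms(1)
proof (induction rule: rtranclp_induct)
  case base
  then show ?case by blast
next
  case (step w w')
  from step.IH show ?case
  proof
    assume "\<exists>r'. v @- r = w @- r'"
    then obtain r' where r': "v @- r = w @- r'" by blast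
    have "even (e + sum_list w)"
      using assms(4) greedy_parity[OF step.hyps(1) assms(2,3)] by auto
    then show ?thesis using greedy_step_dominates[OF step.hyps(2)] assms(5) r' by metis
  next
    assume *: "\<forall>s. parity_less e (w @- s) (v @- r)"
    obtain u where "w' = w @ u" using greedy_prefix step.hyps(2) by blast
    then show ?thesis using * by simp
  qed
qed

text \<open>A competitor that follows \<open>w\<close> must later show a first nonzero symbol. The
  zeros before it keep the parity even, so that symbol loses against 0.\<close>

lemma is_best_greedy_zeros:
  assumes "greedy v w" "q \<ge> 2" "even q" "even (e + sum_list v)" "w @- sconst 0 \<in> inf_words"
  shows "is_best e (with_prefix v inf_words) (w @- sconst 0)"
  unfolding is_best_def
proof (intro conjI ballI impI)
  obtain u where "w = v @ u" using greedy_prefix assms(1) by blast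
  then show "w @- sconst 0 \<in> with_prefix v inf_words" using assms(5) by (auto simp: with_prefix_def)
next
  fix t assume t: "t \<in> with_prefix v inf_words" "t \<noteq> w @- sconst 0"
  then obtain r where r: "t = v @- r" "v @- r \<in> inf_words" by (auto simp: with_prefix_def)
  from greedy_dominates[OF assms(1-4) r(2)]
  show "parity_less e (w @- sconst 0) t"
  proof
    assume "\<exists>r'. v @- r = w @- r'"
    then obtain r' where r': "t = w @- r'" using r by auto
    with t have "r' \<noteq> sconst 0" by auto
    then have ex: "\<exists>i. r' !! i \<noteq> 0"
      using stream_eqI[of r' "sconst 0"] by (metis snth_sset sset_sconst singletonD)
    define i where "i = (LEAST i. r' !! i \<noteq> 0)"
    have i: "r' !! i \<noteq> 0" "\<And>j. j < i \<Longrightarrow> r' !! j = 0"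
      using LeastI_ex[OF ex] not_less_Least unfolding i_def by blast+
    have "stake i r' = replicate i 0"
      by (intro nth_equalityI) (auto simp: i stake_nth)
    then have "t = (w @ replicate i 0) @- (r' !! i) ## sdrop (Suc i) r'"
      using r' id_stake_snth_sdrop[of r' i] by simp
    moreover have "w @- sconst 0 = (w @ replicate i 0) @- 0 ## sconst 0"
      by (simp add: sconst_unfold)
    moreover have "even (e + sum_list (w @ replicate i 0))"
      using assms(4) greedy_parity[OF assms(1-3)] by (auto simp: sum_list_replicate)
    ultimately show ?thesis using i(1) by (simp only: parity_less_shift if_True neq0_conv)
  next
    assume "\<forall>s. parity_less e (w @- s) (v @- r)"
    then show ?thesis using r by blast
  qed
qed

text \<open>At odd parity the largest symbol wins, so the search may be confined to words continuing
  with \<open>q - 1\<close>. This reduces odd prefixes to even ones.\<close>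

lemma is_best_snoc_top:
  assumes best: "is_best e (with_prefix (v @ [q - 1]) inf_words) a" and "odd (e + sum_list v)"
  shows "is_best e (with_prefix v inf_words) a"
  unfolding is_best_def
proof (intro conjI ballI impI)
  show "a \<in> with_prefix v inf_words" using best by (auto simp: is_best_def with_prefix_def)
next
  fix t assume t: "t \<in> with_prefix v inf_words" "t \<noteq> a"
  then obtain x r where r: "t = v @- x ## r" "t \<in> inf_words"
    by (auto simp: with_prefix_def) (metis stream.collapse)
  obtain s where s: "a = v @- (q - 1) ## s" using best by (auto simp: is_best_def with_prefix_def)
  have "x < q" using r by (auto simp: inf_words_avoiding_def streams_iff_sset)
  show "parity_less e a t"
  proof (cases "x = q - 1")
    case True
    then have "t \<in> with_prefix (v @ [q - 1]) inf_words" using r by (auto simp: with_prefix_def)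
    then show ?thesis using best t by (auto simp: is_best_def)
  next
    case False
    then show ?thesis using r s assms(2) \<open>x < q\<close> by (auto intro!: parity_less_shift)
  qed
qed

section \<open>Factors outside \<open>U\<close>: greedy words end in zeros\<close>

lemma greedy_zeros:
  assumes v: "v \<in> words" and inf: "inf_factor (b @ [0]) (v @- sconst 0)"
  shows "\<exists>k. greedy v (v @ replicate k 0) \<and> suffix b (v @ replicate k 0)"
proof -
  obtain n where n: "sublist (b @ [0]) (stake n (v @- sconst 0))"
    using inf by (auto simp: inf_factor_iff_stake)
  have "stake n (v @- sconst 0) = take n v @ replicate (n - length v) 0"
    by (auto simp: stake_shift intro!: nth_equalityI)
  \<comment> \<open>The cut at \<open>n\<close> may fall inside \<open>v\<close> or among the zeros;
    both cases yield a prefix of the same finite word.\<close>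
  moreover have "prefix (take n v @ replicate (n - length v) 0) (v @ replicate n 0)"
    by (cases "n \<le> length v") (auto simp: take_is_prefix prefix_prefix same_prefix_prefix 
        intro!: prefixI[of _ _ "replicate (length v) 0"] simp flip: replicate_add)
  ultimately have ex: "\<exists>j. sublist (b @ [0]) (v @ replicate j 0)"
    using n by (metis prefix_imp_sublist sublist_order.order_trans)
  \<comment> \<open>The \<open>j\<close>-th zero is the first to complete \<open>b @ [0]\<close>.
    Hence \<open>b\<close> is a suffix just before it, and none of the earlier zeros was
    blocked.\<close>
  define j where "j = (LEAST j. sublist (b @ [0]) (v @ replicate j 0))"
  have j: "sublist (b @ [0]) (v @ replicate j 0)"
    and min: "\<And>i. i < j \<Longrightarrow> \<not> sublist (b @ [0]) (v @ replicate i 0)"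
    using LeastI_ex[OF ex] not_less_Least unfolding j_def by blast+
  have "j \<noteq> 0" using j v by (auto simp: words_avoiding_def intro: gr0I)
  then obtain k where k: "j = Suc k" by (cases j) auto
  have snoc: "v @ replicate (Suc i) 0 = (v @ replicate i 0) @ [0]" for i
    by (simp add: replicate_append_same)
  have suf: "suffix b (v @ replicate k 0)"
    using j min[of k] unfolding k snoc snoc_sublist_snoc by simp
  have "greedy v (v @ replicate i 0)" if "i \<le> k" for i
    using that
  proof (induction i)
    case (Suc i)
    have "\<not> suffix b (v @ replicate i 0)"
      using min[of "Suc i"] Suc.prems k unfolding snoc snoc_sublist_snoc by simp
    then have "greedy_step (v @ replicate i 0) (v @ replicate (Suc i) 0)"
      unfolding snoc by (rule greedy_step.zero)
    then show ?case using Suc by (simp add: rtranclp.rtrancl_into_rtrancl)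
  qed simp
  then show ?thesis using suf by blast
qed

text \<open>Otherwise every greedy word runs into another blocked 0. The blocks so produced are all
  equal, and a long enough power of the block ends in \<open>b\<close>, which puts
  \<open>b @ [0]\<close> into \<open>U q\<close>.\<close>

lemma greedy_eventually_zero:
  assumes q: "q \<ge> 2" and v: "v \<in> words" and notU: "b @ [0] \<notin> U q"
  shows "\<exists>w. greedy v w \<and> w @- sconst 0 \<in> inf_words"
proof (rule ccontr)
  assume contra: "\<not> ?thesis"
  have next_block: "\<exists>k. greedy v (w @ replicate k 0) \<and> suffix b (w @ replicate k 0)"
    if w: "greedy v w" for w
  proof -
    have ww: "w \<in> words" using greedy_words w q v by blast
    then have "w @- sconst 0 \<in> streams {..<q}"
      using q by (auto simp: words_avoiding_def intro!: shift_streams sconst_streams)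
    then have "inf_factor (b @ [0]) (w @- sconst 0)"
      using contra w by (auto simp: inf_words_avoiding_def)
    then obtain k where "greedy w (w @ replicate k 0)" "suffix b (w @ replicate k 0)"
      using greedy_zeros ww by blast
    then show ?thesis using w by (meson rtranclp_trans)
  qed
  obtain b' z where b': "b = b' @ replicate z 0" "b' = [] \<or> last b' \<noteq> 0"
    using split_trailing_zeros by blast
  \<comment> \<open>A word \<open>b\<close> of zeros only is a suffix of the single block with
    \<open>m = z\<close>.\<close>
  have "b' \<noteq> []"
  proof
    assume "b' = []"
    then have "suffix b (concat (replicate 1 ([1, q - 1] @ replicate z 0)))"
      using b' by (simp add: suffix_ConsI)
    then show False using notU U_iff by blast
  qed
  with b' obtain b'' x where b'': "b = b'' @ x # replicate z 0" "x \<noteq> 0"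
    by (cases b' rule: rev_cases) auto
  \<comment> \<open>A nonzero \<open>x\<close> precedes the \<open>z\<close> final zeros of
    \<open>b\<close>, so the run of zeros between \<open>q - 1\<close> and a blocked 0 has length
    exactly \<open>z\<close>.\<close>
  have run: "k = z" if suf: "suffix b ((u @ [1, q - 1]) @ replicate k 0)" for u k
  proof -
    obtain s where "(u @ [1, q - 1]) @ replicate k 0 = s @ b"
      using suf unfolding suffix_def by blast
    then have "(u @ [1]) @ (q - 1) # replicate k 0 = (s @ b'') @ x # replicate z 0"
      unfolding b''(1) by simp
    then show ?thesis using trailing_zeros_unique[of "u @ [1]" "q - 1" k] b''(2) q by auto
  qed
  let ?P = "\<lambda>n. concat (replicate n ([1, q - 1] @ replicate z 0))"
  \<comment> \<open>The prefix \<open>u\<close> absorbs \<open>v\<close> and the zeros before the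
    first blocked 0, whose number is unrestricted. The last block is left without its zeros, as
    \<open>run\<close> determines them only at the next blocked 0.\<close>
  have "\<exists>u. greedy v (u @ ?P n @ [1, q - 1])" for n
  proof (induction n)
    case 0
    obtain k where k: "greedy v (v @ replicate k 0)" "suffix b (v @ replicate k 0)"
      using next_block by blast
    then have "greedy v ((v @ replicate k 0) @ [1, q - 1])"
      by (meson greedy_step.one_top rtranclp.rtrancl_into_rtrancl)
    then show ?case by (intro exI[of _ "v @ replicate k 0"]) simp
  next
    case (Suc n)
    then obtain u where u: "greedy v ((u @ ?P n) @ [1, q - 1])" by auto
    then obtain k where k: "greedy v (((u @ ?P n) @ [1, q - 1]) @ replicate k 0)"
      "suffix b (((u @ ?P n) @ [1, q - 1]) @ replicate k 0)"
      using next_block by blast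
    then have "greedy v ((((u @ ?P n) @ [1, q - 1]) @ replicate k 0) @ [1, q - 1])"
      by (meson greedy_step.one_top rtranclp.rtrancl_into_rtrancl)
    moreover have "k = z" using run[OF k(2)] .
    ultimately show ?case unfolding concat_replicate_Suc by (intro exI[of _ u]) simp
  qed
  \<comment> \<open>Blocks are nonempty, so once the pending one is completed, the last
    \<open>Suc (length b)\<close> blocks are longer than \<open>b\<close>.\<close>
  then obtain u where "greedy v ((u @ ?P (length b)) @ [1, q - 1])" by auto
  then obtain k where k: "suffix b (((u @ ?P (length b)) @ [1, q - 1]) @ replicate k 0)"
    using next_block by blast
  then have "suffix b (u @ ?P (Suc (length b)))"
    using run[OF k] unfolding concat_replicate_Suc by simp
  moreover have "length b \<le> length (?P (Suc (length b)))"
    by (simp add: length_concat sum_list_replicate)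
  ultimately have "suffix b (?P (Suc (length b)))"
    by (meson suffix_appendI suffix_length_suffix suffix_order.refl)
  then show False using notU U_iff by blast
qed

lemma induces_zero_periodicity_if_notin_U:
  assumes q: "q \<ge> 2" "even q" and notU: "b @ [0] \<notin> U q"
  shows "induces_zero_periodicity q (b @ [0])"
proof -
  have best: "\<exists>a. is_best e (with_prefix v inf_words) a \<and> ultimate_period a [0]"
    if v: "v \<in> words" "even (e + sum_list v)" for e v
  proof -
    obtain w where "greedy v w" "w @- sconst 0 \<in> inf_words"
      using greedy_eventually_zero[OF q(1) v(1) notU] by blast
    then have "is_best e (with_prefix v inf_words) (w @- sconst 0)"
      using is_best_greedy_zeros q v by blast
    moreover have "ultimate_period (w @- sconst 0) [0]"
      by (auto simp: ultimate_period_def sconst_cycle)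
    ultimately show ?thesis by blast
  qed
  have "\<exists>a. is_best e (with_prefix v inf_words) a \<and> ultimate_period a [0]"
    if v: "v \<in> words" for e v
  proof (cases "even (e + sum_list v)")
    case False
    \<comment> \<open>As \<open>q\<close> is even, \<open>q - 1\<close> is odd and restores even
      parity.\<close>
    have "v @ [q - 1] \<in> words" using snoc_nonzero_in_words v q by simp
    moreover have "even (e + sum_list (v @ [q - 1]))" using False q by simp
    ultimately show ?thesis using best is_best_snoc_top False by meson
  qed (use best v in blast)
  then show ?thesis
    unfolding induces_zero_periodicity_def
    using q by (simp add: is_first_iff_is_best is_last_iff_is_best)
qed

section \<open>Factors in \<open>U\<close>: a greedy word that is periodic with a nonzero
  period\<close>

lemma greedy_block:
  assumes q: "q \<ge> 2" and m: "suffix (replicate m 0) b" and v: "suffix b v"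
  shows "greedy v (v @ [1, q - 1] @ replicate m 0)"
proof -
  have "greedy v (v @ [1, q - 1] @ replicate j 0)" if "j \<le> m" for j
    using that
  proof (induction j)
    case 0
    then show ?case using greedy_step.one_top[OF v] by auto
  next
    case (Suc j)
    \<comment> \<open>With \<open>j < m\<close>, a word ending in \<open>q - 1\<close> and
      \<open>j\<close> zeros cannot end in the \<open>m\<close> zeros that close \<open>b\<close>;
      the zeros of the block are thus unblocked.\<close>
    have "\<not> suffix b (v @ [1, q - 1] @ replicate j 0)"
    proof
      assume "suffix b (v @ [1, q - 1] @ replicate j 0)"
      then have zeros: "suffix (replicate m 0) ((v @ [1]) @ (q - 1) # replicate j 0)"
        using m suffix_order.order_trans by fastforce
      have "suffix ((q - 1) # replicate j 0) ((v @ [1]) @ (q - 1) # replicate j 0)"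
        by (rule suffixI) simp
      from suffix_length_suffix[OF this zeros]
      have "suffix ((q - 1) # replicate j 0) (replicate m 0)" using Suc.prems by simp
      then have "q - 1 \<in> set (replicate m 0)"
        using set_mono_suffix by fastforce
      then show False using q by simp
    qed
    then have "greedy_step (v @ [1, q - 1] @ replicate j 0) ((v @ [1, q - 1] @ replicate j 0) @ [0])"
      by (rule greedy_step.zero)
    moreover have "(v @ [1, q - 1] @ replicate j 0) @ [0] = v @ [1, q - 1] @ replicate (Suc j) 0"
      by (simp add: replicate_append_same)
    ultimately show ?case using Suc by (metis Suc_leD rtranclp.rtrancl_into_rtrancl)
  qed
  then show ?thesis by blast
qed

text \<open>The counterexample prefix is a power of the block that already ends in \<open>b\<close>.
  From there the greedy path repeats the block forever, so the first word is \<open>cycle c\<close>,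
  which is not ultimately zero.\<close>

lemma not_induces_zero_periodicity_if_in_U:
  assumes q: "q \<ge> 2" "even q" and U: "b @ [0] \<in> U q"
  shows "\<not> induces_zero_periodicity q (b @ [0])"
proof
  assume ind: "induces_zero_periodicity q (b @ [0])"
  obtain m n where mn: "suffix b (concat (replicate n ([1, q - 1] @ replicate m 0)))"
    and m: "suffix (replicate m 0) b"
    using U_suffix_zeros[OF U] by blast
  define c where "c = [1, q - 1] @ replicate m 0"
  define P where "P = (\<lambda>n. concat (replicate n c))"
  have c: "c \<noteq> []" by (simp add: c_def)
  have P: "cycle c = P i @- cycle c" for i
    unfolding P_def using cycle_eq_power_shift[OF c] .
  have noruns: "\<not> inf_factor (replicate (Suc m) 0) (cycle c)"
    unfolding c_def using no_long_zero_run q(1) by simp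
  obtain d where d: "b = d @ replicate m 0" using m by (auto simp: suffix_def)
  \<comment> \<open>As \<open>b\<close> ends in \<open>m\<close> zeros, \<open>b @ [0]\<close> ends
    in \<open>m + 1\<close>, a run that \<open>cycle c\<close> lacks.\<close>
  have "\<not> inf_factor (b @ [0]) (cycle c)"
  proof
    assume "inf_factor (b @ [0]) (cycle c)"
    then obtain x y where "cycle c = x @- (b @ [0]) @- y" by (auto simp: inf_factor_def)
    also have "\<dots> = (x @ d) @- replicate (Suc m) 0 @- y"
      unfolding d shift_append[symmetric] by (simp add: replicate_append_same)
    finally show False using noruns unfolding inf_factor_def by blast
  qed
  moreover have "cycle c \<in> streams {..<q}"
    using q c by (auto simp: streams_iff_sset c_def)
  ultimately have a: "cycle c \<in> inf_words" by (simp add: inf_words_avoiding_def)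
  have "P n \<in> words"
  proof -
    have "set (P n) \<subseteq> {..<q}" using q by (auto simp: P_def c_def)
    moreover have "\<not> sublist (b @ [0]) (P n)"
      using sublist_imp_inf_factor[of "b @ [0]" "P n" "cycle c"] P[of n] a
      by (auto simp: inf_words_avoiding_def)
    ultimately show ?thesis by (auto simp: words_avoiding_def)
  qed
  have greedy: "greedy (P n) (P (n + j))" for j
  proof (induction j)
    case (Suc j)
    \<comment> \<open>Each higher power still ends in \<open>P n\<close>, hence in \<open>b\<close>,
      so 0 is blocked and the next block begins.\<close>
    have "P (n + j) = P j @ P n" by (simp add: P_def add.commute replicate_add)
    then have "suffix b (P (n + j))" using mn by (simp add: P_def c_def suffix_appendI)
    then have "greedy (P (n + j)) (P (n + Suc j))"
      using greedy_block[OF q(1) m, of "P (n + j)"]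
      unfolding P_def add_Suc_right concat_replicate_Suc by (simp add: c_def)
    then show ?case using Suc by simp
  qed simp
  have par: "even (0 + sum_list (P n))"
    using q by (induction n) (auto simp: P_def c_def sum_list_replicate)
  have "is_best 0 (with_prefix (P n) inf_words) (cycle c)"
    unfolding is_best_def
  proof (intro conjI ballI impI)
    show "cycle c \<in> with_prefix (P n) inf_words" using a P by (auto simp: with_prefix_def)
  next
    fix t assume t: "t \<in> with_prefix (P n) inf_words" "t \<noteq> cycle c"
    then obtain r where r: "t = P n @- r" "P n @- r \<in> inf_words" by (auto simp: with_prefix_def)
    show "parity_less 0 (cycle c) t"
    proof (rule ccontr)
      assume "\<not> parity_less 0 (cycle c) t"
      \<comment> \<open>Domination with tail \<open>cycle c\<close> is excluded by assumption, so
        \<open>t\<close> follows every greedy prefix. Their lengths are unbounded, which forces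
        \<open>t = cycle c\<close>.\<close>
      then have agree: "\<exists>r'. t = P (n + j) @- r'" for j
        using greedy_dominates[OF greedy q par r(2)] r(1) P by metis
      have "t !! i = cycle c !! i" for i
      proof -
        obtain r' where r': "t = P (n + Suc i) @- r'" using agree by blast
        have "i < length (P (n + Suc i))"
          by (simp add: P_def c_def length_concat sum_list_replicate)
        then show ?thesis using r' P[of "n + Suc i"] by (metis shift_snth_less)
      qed
      then show False using t stream_eqI by blast
    qed
  qed
  moreover obtain a where "is_best 0 (with_prefix (P n) inf_words) a" "ultimate_period a [0]"
    using ind \<open>P n \<in> words\<close> q(2)
    by (auto simp: induces_zero_periodicity_def is_first_iff_is_best)
  ultimately have "ultimate_period (cycle c) [0]" using is_best_unique by metis
  \<comment> \<open>A tail of zeros would contain the excluded run of \<open>m + 1\<close>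
    zeros.\<close>
  then obtain u where "cycle c = u @- replicate (Suc m) 0 @- sconst 0"
    by (auto simp: ultimate_period_def sconst_cycle[symmetric] sconst_unfold)
  then show False using noruns unfolding inf_factor_def by blast
qed

end

theorem theorem1:
  fixes q :: nat and f :: "nat list"
  assumes "q \<ge> 2" and "even q"
    and "f \<in> lists {..<q}" and "f \<noteq> []" and "last f = 0"
  shows "\<not> induces_zero_periodicity q f \<longleftrightarrow> f \<in> U q"
proof -
  have "f = butlast f @ [0]" using assms by (metis append_butlast_last_id)
  then show ?thesis
    using induces_zero_periodicity_if_notin_U not_induces_zero_periodicity_if_in_U assms(1,2)
    by metis
qed

end
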